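(* Let $\lambda>0$ and $0<\alpha\le1$. For every $t>0$ and every integer $n\ge0$, the probability mass function $\hat p_\alpha(n,t)=\Pr\{\hat N_\alpha(t)=n\}$ is given by $$\hat p_\alpha(n,t)=\frac{1}{(2n)!}\frac{\mathrm d^{2n}}{\mathrm ds^{2n}}\left[s^{2n-1}E_{\alpha,1}\left(-\frac{\lambda t^\alpha}{s}\right)\right]_{s=1}+\frac{1}{(2n+1)!}\frac{\mathrm d^{2n+1}}{\mathrm ds^{2n+1}}\left[s^{2n}E_{\alpha,1}\left(-\frac{\lambda t^\alpha}{s}\right)\right]_{s=1}.$$
   Context: Three-parameter Mittag-Leffler function: $E_{\alpha,\beta}^{\gamma}(x)=\frac{1}{\Gamma(\gamma)}\sum_{j=0}^\infty\frac{\Gamma(j+\gamma)x^j}{j!\,\Gamma(j\alpha+\beta)}$ for $\alpha,\beta,\gamma>0$, $x\in\mathbb R$; $E_{\alpha,\beta}=E_{\alpha,\beta}^1$. For $\lambda>0$ and $0<\alpha\le1$, $\{\hat N_\alpha(t)\}_{t\ge0}$ is the renewal counting process with $\hat N_\alpha(0)=0$ whose i.i.d. interarrival times have density $\lambda^2t^{2\alpha-1}E^2_{\alpha,2\alpha}(-\lambda t^\alpha)$, $t>0$. Its probability mass function is, for $n\ge0$, $$\Pr\{\hat N_\alpha(t)=n\}=\lambda^{2n}t^{2n\alpha}E_{\alpha,2n\alpha+1}^{2n+1}(-\lambda t^\alpha)+\lambda^{2n+1}t^{(2n+1)\alpha}E_{\alpha,(2n+1)\alpha+1}^{2n+2}(-\lambda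 t^\alpha).$$ *)

theory Defs
  imports "HOL-Probability.Probability" "HOL-Library.Extended_Nat"
begin

definition mittag_leffler3 :: "real \<Rightarrow> real \<Rightarrow> real \<Rightarrow> real \<Rightarrow> real" where
  "mittag_leffler3 \<alpha> \<beta> \<gamma> x =
     1 / Gamma \<gamma> *
     (\<Sum>j. Gamma (real j + \<gamma>) * x ^ j / (fact j * Gamma (real j * \<alpha> + \<beta>)))"

definition mittag_leffler :: "real \<Rightarrow> real \<Rightarrow> real \<Rightarrow> real" where
  "mittag_leffler \<alpha> \<beta> x = mittag_leffler3 \<alpha> \<beta> 1 x"

definition interarrival_density :: "real \<Rightarrow> real \<Rightarrow> real \<Rightarrow> real" where
  "interarrival_density lam \<alpha> t =
     (if t > 0
      then lam ^ 2 * t powr (2 * \<alpha> - 1) * mittag_leffler3 \<alpha> (2 * \<alpha>) 2 (- lam * t powr \<alpha>)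
      else 0)"

text \<open>
  The number of renewals up to time \<open>t\<close> for the interarrival times \<open>T 0, T 1, \<dots>\<close>, i.e. the
  supremum of all \<open>k\<close> such that the \<open>k\<close>-th renewal epoch \<open>T 0 + \<dots> + T (k - 1)\<close> is at most \<open>t\<close>.
  The values are extended naturals because on a null set of outcomes the renewal epochs may be
  bounded, so that infinitely many renewals occur in finite time.
\<close>
definition renewal_count :: "(nat \<Rightarrow> 'a \<Rightarrow> real) \<Rightarrow> real \<Rightarrow> 'a \<Rightarrow> enat" where
  "renewal_count T t \<omega> = (SUP k \<in> {k. (\<Sum>i<k. T i \<omega>) \<le> t}. enat k)"

end

theory Submission
  imports Defs
begin

text \<open>
  Behind the formula is a calculus that turns renewal theory into algebra of power series. Put
  \<open>y = lam * t powr \<alpha>\<close> and let a power series \<open>\<Sum>N. a N * X ^ N\<close> stand for the function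
  \<open>\<Sum>N. a N * y ^ N / Gamma (\<alpha> * N + 1)\<close> of \<open>t\<close>. (In terms of Laplace transforms,
  \<open>X\<close> stands for \<open>lam * s powr -\<alpha>\<close>.) The Beta integral says that products of power series correspond
  to convolutions. A Mittag-Leffler waiting time, with Laplace transform
  \<open>lam / (lam + s powr \<alpha>)\<close>, corresponds to \<open>R = X / (1 + X)\<close>, and the interarrival density given here,
  whose expansion has the coefficients of \<open>R ^ 2\<close>, is that of the sum of two such waiting times.
  Consequently the \<open>n\<close>-th renewal epoch has the distribution function that belongs to
  \<open>R ^ (2 * n)\<close> (\<open>arrival_cdf\<close>, by induction from \<open>waiting_cdf_convolution\<close>), and since the epochs
  increase, the probability of exactly \<open>n\<close> renewals belongs to \<open>R ^ (2 * n) - R ^ (2 * n + 2)\<close>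
  (\<open>prob_renewal_count_eq\<close>).

  On the other side, differentiating \<open>s powi (m - 1) * E (- y / s)\<close> termwise \<open>m\<close> times at \<open>s = 1\<close> and
  dividing by \<open>fact m\<close> multiplies the \<open>j\<close>-th coefficient of the Mittag-Leffler function by
  \<open>(- 1) ^ m * (j choose m)\<close>. With the sign of \<open>(- y) ^ j\<close> these are the coefficients of
  \<open>X ^ m / (1 + X) ^ (m + 1) = R ^ m - R ^ (m + 1)\<close>
  (\<open>higher_deriv_mittag_leffler_eq_waiting_cdf\<close>). Adding the cases \<open>m = 2 * n\<close> and
  \<open>m = 2 * n + 1\<close> telescopes to the same difference.

  One analytic fact remains: a measure whose density is \<open>ennreal\<close> of a function only sees the
  positive part of that function, so the convolution argument needs the series for the interarrival
  density to be nonnegative, which its alternating signs hide. This is where \<open>\<alpha> \<le> 1\<close> enters.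
  The series is the limit of rescaled coefficients of
  \<open>(c / (c + (1 - z) powr \<alpha>)) ^ 2\<close>, where \<open>c = y / n powr \<alpha>\<close>, by Gauss's product formula
  for the Gamma function and Tannery's theorem. Since \<open>1 - (1 - z) powr \<alpha>\<close> has nonnegative
  coefficients for \<open>0 < \<alpha> \<le> 1\<close>, so has \<open>c / (c + (1 - z) powr \<alpha>)\<close>.
\<close>

section \<open>Bounds for the reciprocal Gamma function\<close>

text \<open>
  Gauss's approximation of \<open>rGamma\<close> is monotone: the quotient of consecutive terms is
  \<open>(1 + a / (n + 1)) * (n / (n + 1)) powr a\<close>, which is at most \<open>1\<close> because
  \<open>1 / (n + 1) \<le> ln ((n + 1) / n)\<close>. A bound for one term thus holds for all later ones and for the
  limit, so the estimates below serve both for convergence of the series and for domination in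
  Tannery's theorem.
\<close>
lemma rGamma_series_Suc_le:
  fixes a :: real
  assumes "a \<ge> 0" "n \<ge> 1"
  shows "rGamma_series a (Suc n) \<le> rGamma_series a n"
proof -
  have "ln (real n / real (Suc n)) \<le> real n / real (Suc n) - 1"
    using assms by (intro ln_le_minus_one) auto
  hence "1 / real (Suc n) \<le> ln (real (Suc n)) - ln (real n)"
    using assms by (simp add: ln_div field_simps)
  hence "a * (1 / real (Suc n)) \<le> a * (ln (real (Suc n)) - ln (real n))"
    using assms by (intro mult_left_mono) auto
  hence "1 + a / real (Suc n) \<le> exp (a * (ln (real (Suc n)) - ln (real n)))"
    using exp_ge_add_one_self[of "a * (ln (real (Suc n)) - ln (real n))"]
    by (simp del: exp_ge_add_one_self)
  hence *: "(1 + a / real (Suc n)) * exp (a * ln (real n)) \<le> exp (a * ln (real (Suc n)))"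
    by (simp add: algebra_simps exp_diff pos_le_divide_eq)
  have "rGamma_series a (Suc n) =
          pochhammer a (Suc n) / (fact n * exp (a * ln (real (Suc n)))) * (1 + a / real (Suc n))"
    by (simp add: rGamma_series_def pochhammer_Suc[of a "Suc n"] field_simps)
  also have "\<dots> \<le> pochhammer a (Suc n) / (fact n * exp (a * ln (real n)))"
  proof -
    have "pochhammer a (Suc n) \<ge> 0"
      using assms by (cases "a = 0") (auto intro: pochhammer_nonneg simp: pochhammer_0_left)
    hence "0 \<le> pochhammer a (Suc n) / (fact n * exp (a * ln (real n)) * exp (a * ln (real (Suc n))))"
      by (intro divide_nonneg_nonneg mult_nonneg_nonneg) simp_all
    from mult_left_mono[OF * this] have "(pochhammer a (Suc n) / (fact n * exp (a * ln (real n)) * exp (a * ln (real (Suc n))))) *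
             ((1 + a / real (Suc n)) * exp (a * ln (real n)))
           \<le> (pochhammer a (Suc n) / (fact n * exp (a * ln (real n)) * exp (a * ln (real (Suc n))))) *
             exp (a * ln (real (Suc n)))" .
    moreover have "p / (f * A * B) * (q * A) = p / (f * B) * q" "p / (f * A * B) * B = p / (f * A)" if "A \<noteq> 0" "B \<noteq> 0" for p f A B q :: real
      using that by auto
    ultimately show ?thesis by (simp only: exp_not_eq_zero not_False_eq_True)
  qed
  also have "\<dots> = rGamma_series a n" by (simp add: rGamma_series_def)
  finally show ?thesis .
qed

lemma power_div_fact_le_exp:
  fixes x :: real
  assumes "x \<ge> 0"
  shows "x ^ n / fact n \<le> exp x"
proof -
  have "(\<Sum>k\<in>{n}. x ^ k /\<^sub>R fact k) \<le> (\<Sum>k. x ^ k /\<^sub>R fact k)"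
    using assms by (intro sum_le_suminf summable_exp_generic) auto
  thus ?thesis by (simp add: exp_def field_simps)
qed

text \<open>
  Each factor of the Pochhammer symbol is at most \<open>a + n\<close>, and \<open>(a + n) ^ n / fact n\<close> is a
  single term of the exponential series.
\<close>
lemma pochhammer_div_fact_le_exp:
  fixes a :: real
  assumes "a \<ge> 0"
  shows "pochhammer a n / fact n \<le> exp (a + n)"
proof -
  have "pochhammer a n \<le> (a + n) ^ n"
    using prod_mono[of "{0..<n}" "\<lambda>i. a + real i" "\<lambda>_. a + real n"] assms
    by (simp add: pochhammer_prod)
  hence "pochhammer a n / fact n \<le> (a + n) ^ n / fact n"
    by (simp add: divide_right_mono)
  also have "\<dots> \<le> exp (a + n)"
    using assms by (intro power_div_fact_le_exp) auto
  finally show ?thesis .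
qed

text \<open>
  The free parameter \<open>M\<close> makes \<open>rGamma\<close> decay faster than any given geometric sequence:
  as a function of \<open>a\<close> the bound is a multiple of \<open>(exp 1 / M) powr a\<close>.
\<close>
lemma rGamma_series_bound:
  fixes a :: real
  assumes "a \<ge> 0" "M \<ge> 1" "n \<ge> M"
  shows "rGamma_series a n \<le> real (Suc M) * exp (Suc M) * exp (a * (1 - ln M))"
proof -
  have "rGamma_series a n \<le> rGamma_series a M"
    using \<open>n \<ge> M\<close>
  proof (induction n rule: dec_induct)
    case (step n)
    thus ?case using rGamma_series_Suc_le[of a n] assms by auto
  qed simp
  also have "\<dots> = pochhammer a (Suc M) / fact (Suc M) * real (Suc M) * exp (- (a * ln M))"
    by (simp add: rGamma_series_def exp_minus field_simps del: of_nat_Suc)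
  also have "\<dots> \<le> exp (a + Suc M) * real (Suc M) * exp (- (a * ln M))"
    using pochhammer_div_fact_le_exp[OF assms(1), of "Suc M"]
    by (intro mult_right_mono) (auto simp del: of_nat_Suc)
  also have "\<dots> = real (Suc M) * exp (Suc M) * exp (a * (1 - ln M))"
    by (simp add: exp_add [symmetric] right_diff_distrib mult_ac add_ac del: of_nat_Suc)
  finally show ?thesis .
qed

lemma rGamma_bound:
  fixes a :: real
  assumes "a \<ge> 0" "M \<ge> 1"
  shows "rGamma a \<le> real (Suc M) * exp (Suc M) * exp (a * (1 - ln M))"
proof (rule tendsto_upperbound[OF rGamma_series_LIMSEQ])
  show "\<forall>\<^sub>F n in sequentially. rGamma_series a n \<le> real (Suc M) * exp (Suc M) * exp (a * (1 - ln M))"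
    using eventually_ge_at_top[of M] by eventually_elim (rule rGamma_series_bound[OF assms])
qed simp

lemma rGamma_real_nonneg: "a \<ge> 0 \<Longrightarrow> rGamma (a :: real) \<ge> 0"
  using Gamma_real_pos[of a] by (cases "a = 0") (auto simp: rGamma_inverse_Gamma)

lemma rGamma_series_nonneg:
  fixes a :: real
  assumes "a \<ge> 0"
  shows "rGamma_series a n \<ge> 0"
  using assms pochhammer_nonneg[of a "Suc n"]
  by (cases "a = 0") (auto simp: rGamma_series_def pochhammer_0_left)

lemma ex_small_exponential:
  fixes \<alpha> K :: real
  assumes "\<alpha> > 0" "K \<ge> 0"
  shows "\<exists>M\<ge>1. K * exp (\<alpha> * (1 - ln (real M))) \<le> 1 / 2"
proof -
  have "((\<lambda>M::nat. K * exp (\<alpha> * (1 - ln (real M)))) \<longlonglongrightarrow> 0)"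
    using assms by real_asymp
  hence "\<forall>\<^sub>F M in sequentially. K * exp (\<alpha> * (1 - ln (real M))) < 1 / 2"
    by (rule order_tendstoD) simp
  hence "\<forall>\<^sub>F M in sequentially. M \<ge> 1 \<and> K * exp (\<alpha> * (1 - ln (real M))) < 1 / 2"
    using eventually_ge_at_top[of 1] by eventually_elim auto
  then obtain M where "M \<ge> 1" "K * exp (\<alpha> * (1 - ln (real M))) < 1 / 2"
    using eventually_happens' sequentially_bot by blast
  thus ?thesis by (intro exI[of _ M]) auto
qed

lemma summable_power_rGamma:
  fixes \<alpha> \<beta> K :: real
  assumes "\<alpha> > 0" "\<beta> \<ge> 0" "K \<ge> 0"
  shows "summable (\<lambda>N. K ^ N * rGamma (\<alpha> * real N + \<beta>))"
proof -
  obtain M where M: "M \<ge> 1" "K * exp (\<alpha> * (1 - ln (real M))) \<le> 1 / 2"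
    using ex_small_exponential[OF assms(1,3)] by blast
  define C where "C = real (Suc M) * exp (Suc M) * exp (\<beta> * (1 - ln (real M)))"
  show ?thesis
  proof (rule summable_comparison_test')
    show "summable (\<lambda>N. C * (1 / 2) ^ N)" by (intro summable_mult summable_geometric) auto
    fix N :: nat
    have "rGamma (\<alpha> * real N + \<beta>) \<le> real (Suc M) * exp (Suc M) * exp ((\<alpha> * real N + \<beta>) * (1 - ln M))"
      using assms M by (intro rGamma_bound) auto
    also have "(\<alpha> * real N + \<beta>) * (1 - ln M) = \<beta> * (1 - ln M) + real N * (\<alpha> * (1 - ln M))"
      by (simp add: algebra_simps)
    also have "real (Suc M) * exp (Suc M) * exp \<dots> = C * exp (\<alpha> * (1 - ln M)) ^ N"
      unfolding C_def exp_add exp_of_nat_mult by (simp only: mult_ac)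
    finally have "K ^ N * rGamma (\<alpha> * real N + \<beta>) \<le> K ^ N * (C * exp (\<alpha> * (1 - ln M)) ^ N)"
      using assms by (intro mult_left_mono) auto
    also have "\<dots> = C * (K * exp (\<alpha> * (1 - ln M))) ^ N"
      by (simp only: power_mult_distrib mult_ac)
    also have "\<dots> \<le> C * (1 / 2) ^ N"
      using M assms by (intro mult_left_mono power_mono) (auto simp: C_def)
    finally show "norm (K ^ N * rGamma (\<alpha> * real N + \<beta>)) \<le> C * (1 / 2) ^ N"
      using assms rGamma_real_nonneg[of "\<alpha> * real N + \<beta>"] by (simp add: abs_mult)
  qed
qed

section \<open>Coefficients of powers of X / (1 + X)\<close>

text \<open>
  The Laplace transform \<open>lam / (lam + s powr \<alpha>)\<close> of a Mittag-Leffler waiting time in the variable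
  \<open>X = lam * s powr -\<alpha>\<close>.
\<close>
definition waiting_fps :: "real fps" where
  "waiting_fps = fps_X * inverse (1 + fps_X)"

definition waiting_coeff :: "nat \<Rightarrow> nat \<Rightarrow> real" where
  "waiting_coeff m N = fps_nth (waiting_fps ^ m) N"

lemma waiting_fps_mult: "(1 + fps_X) * waiting_fps = fps_X"
  by (simp add: waiting_fps_def mult.left_commute inverse_mult_eq_1')

lemma waiting_coeff_0_left: "waiting_coeff 0 N = (if N = 0 then 1 else 0)"
  by (simp add: waiting_coeff_def)

lemma waiting_coeff_Suc_0 [simp]: "waiting_coeff (Suc m) 0 = 0"
  by (simp add: waiting_coeff_def waiting_fps_def)

text \<open>
  Coefficientwise form of \<open>(1 + X) * R ^ (m + 1) = X * R ^ m\<close>.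
\<close>
lemma waiting_coeff_Suc_Suc:
  "waiting_coeff (Suc m) (Suc N) = waiting_coeff m N - waiting_coeff (Suc m) N"
proof -
  have "(1 + fps_X) * waiting_fps ^ Suc m = fps_X * waiting_fps ^ m"
    by (simp add: mult.assoc [symmetric] waiting_fps_mult)
  hence "fps_nth ((1 + fps_X) * waiting_fps ^ Suc m) (Suc N) = fps_nth (fps_X * waiting_fps ^ m) (Suc N)"
    by (rule arg_cong)
  thus ?thesis by (simp add: waiting_coeff_def distrib_right del: power_Suc)
qed

text \<open>
  The bound is crude but uniform in \<open>m\<close>; geometric growth is harmless against the decay of
  \<open>rGamma\<close>.
\<close>
lemma abs_waiting_coeff_le: "\<bar>waiting_coeff m N\<bar> \<le> 2 ^ N"
proof (induction N arbitrary: m)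
  case 0
  show ?case by (cases m) (auto simp: waiting_coeff_0_left)
next
  case (Suc N)
  show ?case
  proof (cases m)
    case (Suc k)
    thus ?thesis
      using Suc.IH[of k] Suc.IH[of m] by (simp add: waiting_coeff_Suc_Suc)
  qed (auto simp: waiting_coeff_0_left)
qed

lemma waiting_coeff_add:
  "waiting_coeff (m + k) n = (\<Sum>i\<le>n. waiting_coeff m i * waiting_coeff k (n - i))"
  by (simp add: waiting_coeff_def power_add fps_mult_nth atLeast0AtMost)

lemma waiting_coeff_1_Suc: "waiting_coeff 1 (Suc j) = (-1) ^ j"
proof (induction j)
  case (Suc j)
  thus ?case using waiting_coeff_Suc_Suc[of 0 "Suc j"] by (simp add: waiting_coeff_0_left)
qed (use waiting_coeff_Suc_Suc[of 0 0] in \<open>simp add: waiting_coeff_0_left\<close>)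

lemma waiting_coeff_2_Suc: "waiting_coeff 2 (Suc j) = - ((-1) ^ j * real j)"
proof (induction j)
  case (Suc j)
  thus ?case using waiting_coeff_Suc_Suc[of 1 "Suc j"] waiting_coeff_1_Suc[of j]
    by (simp add: numeral_2_eq_2 algebra_simps)
qed (use waiting_coeff_Suc_Suc[of 1 0] in \<open>simp add: numeral_2_eq_2\<close>)

text \<open>
  The difference is \<open>R ^ m * (1 - R) = X ^ m / (1 + X) ^ (m + 1)\<close>, and the recurrence of its
  coefficients is Pascal's rule.
\<close>
lemma waiting_coeff_diff:
  "waiting_coeff m j - waiting_coeff (Suc m) j = (-1) ^ (j + m) * real (j choose m)"
proof (induction j arbitrary: m)
  case 0
  show ?case by (cases m) (auto simp: waiting_coeff_0_left)
next
  case (Suc j)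
  show ?case
  proof (cases m)
    case 0
    thus ?thesis using waiting_coeff_1_Suc[of j] by (simp add: waiting_coeff_0_left)
  next
    case [simp]: (Suc k)
    show ?thesis
      using Suc.IH[of k] Suc.IH[of m]
      by (simp add: waiting_coeff_Suc_Suc algebra_simps)
  qed
qed

section \<open>Nonnegativity of the density\<close>

text \<open>
  The binomial series of \<open>(1 - z) powr -a\<close>.
\<close>
definition neg_binomial_fps :: "real \<Rightarrow> real fps" where
  "neg_binomial_fps a = Abs_fps (\<lambda>n. pochhammer a n / fact n)"

lemma neg_binomial_fps_nth: "fps_nth (neg_binomial_fps a) n = pochhammer a n / fact n"
  by (simp add: neg_binomial_fps_def)

text \<open>
  The power law \<open>(1 - z) powr -(a + b) = (1 - z) powr -a * (1 - z) powr -b\<close>, that is, the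
  Chu-Vandermonde identity.
\<close>
lemma neg_binomial_fps_add:
  "neg_binomial_fps (a + b) = neg_binomial_fps a * neg_binomial_fps b"
proof (rule fps_ext)
  fix n
  have "pochhammer (a + b) n / fact n =
          (\<Sum>k\<le>n. real (n choose k) * pochhammer a k * pochhammer b (n - k) / fact n)"
    by (simp add: pochhammer_binomial_sum sum_divide_distrib)
  also have "\<dots> = (\<Sum>k\<le>n. pochhammer a k / fact k * (pochhammer b (n - k) / fact (n - k)))"
    by (intro sum.cong refl) (simp add: binomial_fact)
  finally show "fps_nth (neg_binomial_fps (a + b)) n =
                  fps_nth (neg_binomial_fps a * neg_binomial_fps b) n"
    by (simp add: fps_mult_nth atLeast0AtMost neg_binomial_fps_nth)
qed

text \<open>
  \<open>R ^ m\<close> with \<open>c * (1 - z) powr -\<alpha>\<close> substituted for \<open>X\<close>: a discrete analogue of the density of \<open>m\<close>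
  Mittag-Leffler waiting times, equal to \<open>(c / (c + (1 - z) powr \<alpha>)) ^ m\<close> when \<open>c > 0\<close> is small.
\<close>
definition discrete_fps :: "real \<Rightarrow> real \<Rightarrow> nat \<Rightarrow> real fps" where
  "discrete_fps \<alpha> c m =
     Abs_fps (\<lambda>n. \<Sum>N. waiting_coeff m N * c ^ N * fps_nth (neg_binomial_fps (\<alpha> * real N)) n)"

lemma summable_discrete_fps:
  assumes "\<alpha> > 0" "c > 0" "2 * c * exp \<alpha> \<le> 1 / 2"
  shows "summable (\<lambda>N. waiting_coeff m N * c ^ N * fps_nth (neg_binomial_fps (\<alpha> * real N)) n)"
proof (rule summable_comparison_test')
  show "summable (\<lambda>N. exp n * (1 / 2) ^ N :: real)"
    by (intro summable_mult summable_geometric) auto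
  fix N :: nat
  have pos: "pochhammer (\<alpha> * real N) n \<ge> 0"
    using assms pochhammer_nonneg[of "\<alpha> * real N" n] by (cases "N = 0") (auto simp: pochhammer_0_left)
  have "norm (waiting_coeff m N * c ^ N * fps_nth (neg_binomial_fps (\<alpha> * real N)) n)
          = \<bar>waiting_coeff m N\<bar> * c ^ N * (pochhammer (\<alpha> * real N) n / fact n)"
    using assms pos by (simp add: abs_mult neg_binomial_fps_nth)
  also have "\<dots> \<le> 2 ^ N * c ^ N * exp (\<alpha> * real N + real n)"
    using assms pos
    by (intro mult_mono abs_waiting_coeff_le pochhammer_div_fact_le_exp mult_nonneg_nonneg) auto
  also have "exp (\<alpha> * real N + real n) = exp n * exp \<alpha> ^ N"
    by (simp add: exp_add exp_of_nat2_mult)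
  also have "2 ^ N * c ^ N * (exp n * exp \<alpha> ^ N) = exp n * (2 * c * exp \<alpha>) ^ N"
    by (simp add: power_mult_distrib)
  also have "\<dots> \<le> exp n * (1 / 2) ^ N"
    using assms by (intro mult_left_mono power_mono) auto
  finally show "norm (waiting_coeff m N * c ^ N * fps_nth (neg_binomial_fps (\<alpha> * real N)) n)
                  \<le> exp n * (1 / 2) ^ N" .
qed

text \<open>
  Substituting \<open>c * (1 - z) powr -\<alpha>\<close> for \<open>X\<close> in
  \<open>(1 + X) * R ^ (m + 1) = X * R ^ m\<close> and multiplying by \<open>(1 - z) powr \<alpha>\<close>. Since the substituted
  series has the nonzero constant term \<open>c\<close>, this is not a composition of formal power series: every
  coefficient is an infinite sum, which converges for small \<open>c\<close>.
\<close>
lemma discrete_fps_recurrence: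
  assumes "\<alpha> > 0" "c > 0" "2 * c * exp \<alpha> \<le> 1 / 2"
  shows "(neg_binomial_fps (-\<alpha>) + fps_const c) * discrete_fps \<alpha> c (Suc m) =
           fps_const c * discrete_fps \<alpha> c m"
proof (rule fps_ext)
  fix n
  let ?v = "\<lambda>a. fps_nth (neg_binomial_fps a)"
  define q where "q = (\<lambda>m N n. waiting_coeff m N * c ^ N * ?v (\<alpha> * real N) n)"
  have summ: "summable (\<lambda>N. q m N n)" for m n
    unfolding q_def by (rule summable_discrete_fps[OF assms])
  have Q: "fps_nth (discrete_fps \<alpha> c m) n = (\<Sum>N. q m N n)" for m n
    by (simp add: discrete_fps_def q_def)
  have conv: "(\<Sum>i\<le>n. ?v (-\<alpha>) i * q (Suc m) N (n - i)) =
                waiting_coeff (Suc m) N * c ^ N * ?v (\<alpha> * real N - \<alpha>) n" for N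
    using neg_binomial_fps_add[of "-\<alpha>" "\<alpha> * real N"]
    by (simp add: q_def fps_mult_nth atLeast0AtMost sum_distrib_left mult_ac)
  have summ': "summable (\<lambda>N. waiting_coeff (Suc m) N * c ^ N * ?v (\<alpha> * real N - \<alpha>) n)"
    unfolding conv [symmetric] by (intro summable_sum summable_mult summ)
  have "fps_nth (neg_binomial_fps (-\<alpha>) * discrete_fps \<alpha> c (Suc m)) n =
          (\<Sum>i\<le>n. \<Sum>N. ?v (-\<alpha>) i * q (Suc m) N (n - i))"
    by (simp add: fps_mult_nth atLeast0AtMost Q suminf_mult[OF summ])
  also have "\<dots> = (\<Sum>N. \<Sum>i\<le>n. ?v (-\<alpha>) i * q (Suc m) N (n - i))"
    by (intro suminf_sum [symmetric] summable_mult summ)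
  also have "\<dots> = (\<Sum>N. waiting_coeff (Suc m) (Suc N) * c ^ Suc N * ?v (\<alpha> * real N) n)"
    unfolding conv using suminf_split_head[OF summ'] by (simp add: algebra_simps)
  finally have 1: "fps_nth (neg_binomial_fps (-\<alpha>) * discrete_fps \<alpha> c (Suc m)) n = \<dots>" .
  have summ'': "summable (\<lambda>N. waiting_coeff (Suc m) (Suc N) * c ^ Suc N * ?v (\<alpha> * real N) n)"
    using summ'[THEN summable_Suc_iff[THEN iffD2]] by (simp add: algebra_simps)
  have "fps_nth ((neg_binomial_fps (-\<alpha>) + fps_const c) * discrete_fps \<alpha> c (Suc m)) n =
     (\<Sum>N. waiting_coeff (Suc m) (Suc N) * c ^ Suc N * ?v (\<alpha> * real N) n) + (\<Sum>N. c * q (Suc m) N n)"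
    by (simp add: distrib_right 1 Q suminf_mult[OF summ])
  also have "\<dots> = (\<Sum>N. c * q m N n)"
    by (subst suminf_add[OF summ'' summable_mult[OF summ]])
       (intro suminf_cong, simp add: q_def waiting_coeff_Suc_Suc algebra_simps)
  finally show "fps_nth ((neg_binomial_fps (-\<alpha>) + fps_const c) * discrete_fps \<alpha> c (Suc m)) n =
                  fps_nth (fps_const c * discrete_fps \<alpha> c m) n"
    by (simp add: Q suminf_mult[OF summ])
qed

lemma pochhammer_neg_nonpos:
  fixes \<alpha> :: real
  assumes "0 < \<alpha>" "\<alpha> \<le> 1" "n > 0"
  shows "pochhammer (-\<alpha>) n \<le> 0"
proof -
  obtain k where n: "n = Suc k" using assms by (cases n) auto
  have "pochhammer (1 - \<alpha>) k \<ge> 0"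
    using assms pochhammer_nonneg[of "1 - \<alpha>" k]
    by (cases "\<alpha> = 1") (auto simp: pochhammer_0_left)
  thus ?thesis using assms by (simp add: n pochhammer_rec mult_nonneg_nonneg)
qed

text \<open>
  Apart from its constant term \<open>1\<close>, the series \<open>(1 - z) powr \<alpha>\<close> has only nonpositive
  coefficients. Comparing coefficients in \<open>discrete_fps_recurrence\<close> therefore expresses
  \<open>(1 + c)\<close> times each new coefficient as a sum of nonnegative terms.
\<close>
lemma discrete_fps_nonneg:
  assumes "0 < \<alpha>" "\<alpha> \<le> 1" "c > 0" "2 * c * exp \<alpha> \<le> 1 / 2"
  shows "fps_nth (discrete_fps \<alpha> c m) n \<ge> 0"
proof (induction m arbitrary: n)
  case 0
  have "(\<Sum>N. waiting_coeff 0 N * c ^ N * fps_nth (neg_binomial_fps (\<alpha> * real N)) n) =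
        (\<Sum>N\<in>{0}. waiting_coeff 0 N * c ^ N * fps_nth (neg_binomial_fps (\<alpha> * real N)) n)"
    by (intro suminf_finite) (auto simp: waiting_coeff_0_left)
  thus ?case by (simp add: discrete_fps_def waiting_coeff_0_left neg_binomial_fps_nth pochhammer_0_left)
next
  case (Suc m n)
  let ?Q = "discrete_fps \<alpha> c (Suc m)" and ?V = "neg_binomial_fps (-\<alpha>)"
  show ?case
  proof (induction n rule: less_induct)
    case (less n)
    have "fps_nth (?V * ?Q) n + c * fps_nth ?Q n = c * fps_nth (discrete_fps \<alpha> c m) n"
      using arg_cong[OF discrete_fps_recurrence[OF assms(1,3,4), of m], of "\<lambda>F. fps_nth F n"]
      by (simp add: distrib_right)
    hence "(\<Sum>i\<le>n. fps_nth ?V i * fps_nth ?Q (n - i)) + c * fps_nth ?Q n =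
            c * fps_nth (discrete_fps \<alpha> c m) n"
      by (simp add: fps_mult_nth atLeast0AtMost)
    also have "(\<Sum>i\<le>n. fps_nth ?V i * fps_nth ?Q (n - i)) =
                 fps_nth ?Q n + (\<Sum>i\<in>{1..n}. fps_nth ?V i * fps_nth ?Q (n - i))"
      by (simp add: neg_binomial_fps_nth atLeast0AtMost [symmetric] sum.atLeast_Suc_atMost)
    finally have "(1 + c) * fps_nth ?Q n = c * fps_nth (discrete_fps \<alpha> c m) n -
                    (\<Sum>i\<in>{1..n}. fps_nth ?V i * fps_nth ?Q (n - i))"
      by (simp add: algebra_simps)
    moreover have "(\<Sum>i\<in>{1..n}. fps_nth ?V i * fps_nth ?Q (n - i)) \<le> 0"
      using less pochhammer_neg_nonpos[OF assms(1,2)]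
      by (intro sum_nonpos mult_nonpos_nonneg)
         (auto simp: neg_binomial_fps_nth divide_nonpos_nonneg)
    ultimately have "(1 + c) * fps_nth ?Q n \<ge> 0"
      using mult_nonneg_nonneg[of c, OF _ Suc.IH[of n]] assms by linarith
    thus ?case using assms by (simp add: zero_le_mult_iff)
  qed
qed

text \<open>
  With \<open>c = y * n powr -\<alpha>\<close>, the coefficient of index \<open>n + 1\<close> of the discrete series, multiplied by
  \<open>n + 1\<close>, is the given series with \<open>rGamma\<close> replaced by its \<open>n\<close>-th Gauss approximation. These
  numbers are nonnegative as soon as \<open>c\<close> is small, and they converge to the given series by Tannery's
  theorem.
\<close>
lemma waiting_series_nonneg:
  assumes "0 < \<alpha>" "\<alpha> \<le> 1" "y > 0"
  shows "(\<Sum>N. waiting_coeff m N * y ^ N * rGamma (\<alpha> * real N)) \<ge> 0"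
proof -
  \<comment> \<open>The factor \<open>2\<close> absorbs the growth of the coefficients.\<close>
  obtain M where M: "M \<ge> 1" "2 * y * exp (\<alpha> * (1 - ln (real M))) \<le> 1 / 2"
    using ex_small_exponential[of \<alpha> "2 * y"] assms by auto
  define C where "C = real (Suc M) * exp (Suc M)"
  have bound: "norm (waiting_coeff m N * y ^ N * rGamma_series (\<alpha> * real N) n) \<le> C * (1 / 2) ^ N"
    if "n \<ge> M" for n N
  proof -
    have nonneg: "rGamma_series (\<alpha> * real N) n \<ge> 0"
      using assms by (intro rGamma_series_nonneg) auto
    have "norm (waiting_coeff m N * y ^ N * rGamma_series (\<alpha> * real N) n) =
            \<bar>waiting_coeff m N\<bar> * y ^ N * rGamma_series (\<alpha> * real N) n"
      using assms nonneg by (simp add: abs_mult)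
    also have "\<dots> \<le> 2 ^ N * y ^ N * (C * exp (\<alpha> * real N * (1 - ln (real M))))"
      unfolding C_def using assms nonneg M that
      by (intro mult_mono abs_waiting_coeff_le rGamma_series_bound mult_nonneg_nonneg) auto
    also have "\<alpha> * real N * (1 - ln (real M)) = real N * (\<alpha> * (1 - ln (real M)))"
      by simp
    also have "2 ^ N * y ^ N * (C * exp \<dots>) = C * (2 * y * exp (\<alpha> * (1 - ln (real M)))) ^ N"
      unfolding exp_of_nat_mult by (simp add: power_mult_distrib)
    also have "\<dots> \<le> C * (1 / 2) ^ N"
      using M assms by (intro mult_left_mono power_mono) (auto simp: C_def)
    finally show ?thesis .
  qed
  have lim: "(\<lambda>n. \<Sum>N. waiting_coeff m N * y ^ N * rGamma_series (\<alpha> * real N) n) \<longlonglongrightarrow>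
               (\<Sum>N. waiting_coeff m N * y ^ N * rGamma (\<alpha> * real N))"
  proof (rule tannerys_theorem[THEN conjunct2, THEN conjunct2])
    show "(\<lambda>n. waiting_coeff m N * y ^ N * rGamma_series (\<alpha> * real N) n) \<longlonglongrightarrow>
            waiting_coeff m N * y ^ N * rGamma (\<alpha> * real N)" for N
      by (intro tendsto_intros)
    have "\<forall>\<^sub>F x in at_top \<times>\<^sub>F sequentially. M \<le> snd (x :: nat \<times> nat)"
      using eventually_prod2[of "at_top :: nat filter" "\<lambda>n. M \<le> n" sequentially] eventually_ge_at_top[of M]
      by (simp add: case_prod_unfold)
    thus "\<forall>\<^sub>F (N, n) in at_top \<times>\<^sub>F sequentially.
            norm (waiting_coeff m N * y ^ N * rGamma_series (\<alpha> * real N) n) \<le> C * (1 / 2) ^ N"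
      by eventually_elim (simp only: case_prod_unfold bound)
    show "summable (\<lambda>N. C * (1 / 2) ^ N)" by (intro summable_mult summable_geometric) auto
  qed auto
  \<comment> \<open>Once \<open>c = y * n powr -\<alpha>\<close> is small enough, the discrete series converges.\<close>
  have "(\<lambda>n. 2 * (y * exp (- \<alpha> * ln (real n))) * exp \<alpha>) \<longlonglongrightarrow> 0"
    using assms by real_asymp
  hence "\<forall>\<^sub>F n in sequentially. 2 * (y * exp (- \<alpha> * ln (real n))) * exp \<alpha> < 1 / 2"
    by (rule order_tendstoD) simp
  hence "\<forall>\<^sub>F n in sequentially. 0 \<le> (\<Sum>N. waiting_coeff m N * y ^ N * rGamma_series (\<alpha> * real N) n)"
  proof eventually_elim
    case (elim n)
    define c where "c = y * exp (- \<alpha> * ln (real n))"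
    have c: "c > 0" "2 * c * exp \<alpha> \<le> 1 / 2" using elim assms by (auto simp: c_def)
    have eq: "waiting_coeff m N * y ^ N * rGamma_series (\<alpha> * real N) n =
      real (Suc n) * (waiting_coeff m N * c ^ N * fps_nth (neg_binomial_fps (\<alpha> * real N)) (Suc n))" for N
    proof -
      have "c ^ N = y ^ N * exp (real N * (- \<alpha> * ln (real n)))"
        unfolding exp_of_nat_mult c_def by (rule power_mult_distrib)
      also have "exp (real N * (- \<alpha> * ln (real n))) = inverse (exp (\<alpha> * real N * ln (real n)))"
        by (simp add: exp_minus [symmetric] mult_ac)
      finally show ?thesis
        by (simp add: rGamma_series_def neg_binomial_fps_nth divide_simps del: of_nat_Suc)
    qed
    have "(\<Sum>N. waiting_coeff m N * y ^ N * rGamma_series (\<alpha> * real N) n) =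
            real (Suc n) * fps_nth (discrete_fps \<alpha> c m) (Suc n)"
      unfolding eq by (simp add: discrete_fps_def suminf_mult[OF summable_discrete_fps[OF assms(1) c]]
                            del: of_nat_Suc)
    also have "\<dots> \<ge> 0"
      using discrete_fps_nonneg[OF assms(1,2) c] by (intro mult_nonneg_nonneg) auto
    finally show ?case .
  qed
  thus ?thesis by (intro tendsto_lowerbound[OF lim]) auto
qed

section \<open>Convolution of the kernels\<close>

text \<open>
  The distribution function of the sum of \<open>m\<close> Mittag-Leffler waiting times, on \<open>t \<ge> 0\<close>.
\<close>
definition waiting_cdf :: "real \<Rightarrow> real \<Rightarrow> nat \<Rightarrow> real \<Rightarrow> real" where
  "waiting_cdf \<alpha> lam m t = (\<Sum>N. waiting_coeff m N * (lam * t powr \<alpha>) ^ N * rGamma (\<alpha> * real N + 1))"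

text \<open>
  The density of the sum of \<open>k > 0\<close> Mittag-Leffler waiting times, on \<open>t > 0\<close>. Dividing by \<open>t\<close> outside
  the series keeps it a power series in \<open>lam * t powr \<alpha>\<close>.
\<close>
definition waiting_density :: "real \<Rightarrow> real \<Rightarrow> nat \<Rightarrow> real \<Rightarrow> real" where
  "waiting_density \<alpha> lam k t = (\<Sum>N. waiting_coeff k N * (lam * t powr \<alpha>) ^ N * rGamma (\<alpha> * real N)) / t"

lemma summable_waiting_series:
  assumes "\<alpha> > 0" "\<beta> \<ge> 0"
  shows "summable (\<lambda>N. norm (waiting_coeff m N * y ^ N * rGamma (\<alpha> * real N + \<beta>)))"
proof (rule summable_comparison_test')
  show "summable (\<lambda>N. (2 * \<bar>y\<bar>) ^ N * rGamma (\<alpha> * real N + \<beta>))"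
    using assms by (intro summable_power_rGamma) auto
  fix N :: nat
  have "rGamma (\<alpha> * real N + \<beta>) \<ge> 0" using assms by (intro rGamma_real_nonneg) auto
  thus "norm (norm (waiting_coeff m N * y ^ N * rGamma (\<alpha> * real N + \<beta>)))
          \<le> (2 * \<bar>y\<bar>) ^ N * rGamma (\<alpha> * real N + \<beta>)"
    unfolding power_mult_distrib using abs_waiting_coeff_le[of m N]
    by (auto simp: abs_mult power_abs intro!: mult_right_mono)
qed

text \<open>
  Euler's Beta integral, rescaled from the unit interval to \<open>(0, t)\<close>.
\<close>
lemma Beta_convolution:
  fixes p q t :: real
  assumes "p > 0" "q > 0" "t > 0"
  shows "has_bochner_integral lborel
           (\<lambda>s. indicator {0<..<t} s * ((t - s) powr (p - 1) * s powr (q - 1)))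
           (Beta p q * t powr (p + q - 1))"
proof -
  define h where "h = (\<lambda>u::real. indicator {0<..<1} u * (u powr (q - 1) * (1 - u) powr (p - 1)))"
  have B: "((\<lambda>u. u powr (q - 1) * (1 - u) powr (p - 1)) has_integral Beta q p) {0<..<1}"
    using has_integral_Beta_real[OF assms(2,1)] by (simp add: has_integral_Icc_iff_Ioo)
  have "has_bochner_integral lborel h (Beta q p)"
  proof (rule has_bochner_integral_nn_integral)
    show "integral\<^sup>N lborel h = ennreal (Beta q p)"
      unfolding h_def by (rule nn_integral_has_integral_lebesgue[OF _ B]) auto
    show "0 \<le> Beta q p"
      using B by (rule has_integral_nonneg) auto
  qed (auto simp: h_def)
  hence "has_bochner_integral lborel (\<lambda>s. h (0 + (1 / t) * s)) (Beta q p /\<^sub>R \<bar>1 / t\<bar>)"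
    using assms by (subst lborel_has_bochner_integral_real_affine_iff [symmetric]) auto
  hence "has_bochner_integral lborel (\<lambda>s. t powr (p + q - 2) * h (0 + (1 / t) * s))
           (t powr (p + q - 2) * (Beta q p /\<^sub>R \<bar>1 / t\<bar>))"
    by (intro has_bochner_integral_mult_right)
  also have "(\<lambda>s. t powr (p + q - 2) * h (0 + (1 / t) * s)) =
               (\<lambda>s. indicator {0<..<t} s * ((t - s) powr (p - 1) * s powr (q - 1)))"
  proof
    fix s
    show "t powr (p + q - 2) * h (0 + (1 / t) * s) =
            indicator {0<..<t} s * ((t - s) powr (p - 1) * s powr (q - 1))"
    proof (cases "0 < s \<and> s < t")
      case True
      have "1 - s / t = (t - s) / t" using assms by (simp add: field_simps)
      moreover have "t powr (p + q - 2) = t powr (p - 1) * t powr (q - 1)"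
        by (simp add: powr_add [symmetric])
      ultimately show ?thesis using True assms by (simp add: h_def powr_divide)
    qed (use assms in \<open>auto simp: h_def indicator_def field_simps\<close>)
  qed
  also have "t powr (p + q - 2) * (Beta q p /\<^sub>R \<bar>1 / t\<bar>) = Beta p q * (t powr (p + q - 2) * t powr 1)"
    using assms by (simp add: Beta_commute)
  also have "t powr (p + q - 2) * t powr 1 = t powr (p + q - 1)"
    unfolding powr_add [symmetric] by simp
  finally show ?thesis .
qed

text \<open>
  The kernels that stand for \<open>X ^ i\<close> (integrated form) and \<open>X ^ j\<close> (density form) convolve to the
  integrated kernel that stands for \<open>X ^ (i + j)\<close>.
\<close>
lemma power_kernel_convolution:
  fixes \<alpha> t :: real
  assumes "\<alpha> > 0" "t > 0" "j > 0"
  shows "has_bochner_integral lborel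
           (\<lambda>s. indicator {0<..<t} s * (((t - s) powr \<alpha>) ^ i * rGamma (\<alpha> * real i + 1) *
                                        ((s powr \<alpha>) ^ j * rGamma (\<alpha> * real j) / s)))
           ((t powr \<alpha>) ^ (i + j) * rGamma (\<alpha> * real (i + j) + 1))"
proof -
  let ?p = "\<alpha> * real i + 1" and ?q = "\<alpha> * real j"
  have comm: "real n * \<alpha> = \<alpha> * real n" for n by simp
  have pos: "?p > 0" "?q > 0"
    using assms by (auto intro: add_nonneg_pos)
  have "has_bochner_integral lborel
          (\<lambda>s. rGamma ?p * rGamma ?q * (indicator {0<..<t} s * ((t - s) powr (?p - 1) * s powr (?q - 1))))
          (rGamma ?p * rGamma ?q * (Beta ?p ?q * t powr (?p + ?q - 1)))"
    by (intro has_bochner_integral_mult_right Beta_convolution pos assms)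
  also have "(\<lambda>s. rGamma ?p * rGamma ?q * (indicator {0<..<t} s * ((t - s) powr (?p - 1) * s powr (?q - 1)))) =
     (\<lambda>s. indicator {0<..<t} s * (((t - s) powr \<alpha>) ^ i * rGamma ?p * ((s powr \<alpha>) ^ j * rGamma ?q / s)))"
  proof
    fix s
    show "rGamma ?p * rGamma ?q * (indicator {0<..<t} s * ((t - s) powr (?p - 1) * s powr (?q - 1))) =
          indicator {0<..<t} s * (((t - s) powr \<alpha>) ^ i * rGamma ?p * ((s powr \<alpha>) ^ j * rGamma ?q / s))"
      by (cases "0 < s \<and> s < t") (auto simp: powr_power powr_diff indicator_def comm)
  qed
  also have "rGamma ?p * rGamma ?q * (Beta ?p ?q * t powr (?p + ?q - 1)) =
               t powr (?p + ?q - 1) * rGamma (?p + ?q)"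
  proof -
    have "inverse A * inverse B * (A * B * C * T) = T * C" if "A > 0" "B > 0" for A B C T :: real
      using that by (simp add: field_simps)
    from this[OF Gamma_real_pos Gamma_real_pos, OF pos] show ?thesis
      unfolding Beta_altdef rGamma_inverse_Gamma .
  qed
  also have "t powr (?p + ?q - 1) = (t powr \<alpha>) ^ (i + j)"
    using assms by (simp add: powr_power algebra_simps)
  also have "?p + ?q = \<alpha> * real (i + j) + 1"
    by (simp add: algebra_simps)
  finally show ?thesis .
qed

text \<open>
  Both series converge absolutely, so the integrand is the sum of their Cauchy product. Its \<open>n\<close>-th
  term integrates, by \<open>power_kernel_convolution\<close>, to a multiple of one kernel whose factor is the
  \<open>n\<close>-th coefficient of \<open>R ^ m * R ^ k\<close>. The interchange of sum and integral is justified by the same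
  integrals with absolute values of the coefficients.
\<close>
lemma waiting_cdf_convolution:
  fixes \<alpha> lam t :: real
  assumes "\<alpha> > 0" "lam > 0" "t > 0" "k > 0"
  shows "has_bochner_integral lborel
           (\<lambda>s. indicator {0<..<t} s * (waiting_cdf \<alpha> lam m (t - s) * waiting_density \<alpha> lam k s))
           (waiting_cdf \<alpha> lam (m + k) t)"
proof -
  have k0: "waiting_coeff k 0 = 0" using assms by (cases k) auto
  define u where "u = (\<lambda>i s. ((t - s) powr \<alpha>) ^ i * rGamma (\<alpha> * real i + 1))"
  define v where "v = (\<lambda>j s. (s powr \<alpha>) ^ j * rGamma (\<alpha> * real j) / s)"
  define J where "J = (\<lambda>n. (t powr \<alpha>) ^ n * rGamma (\<alpha> * real n + 1))"
  define w where "w = (\<lambda>n s. \<Sum>i\<le>n. lam ^ n * (waiting_coeff m i * waiting_coeff k (n - i)) *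
                                      (indicator {0<..<t} s * (u i s * v (n - i) s)))"
  have J_nonneg: "J n \<ge> 0" for n
    using assms by (auto simp: J_def intro!: mult_nonneg_nonneg rGamma_real_nonneg)
  have uv: "has_bochner_integral lborel (\<lambda>s. indicator {0<..<t} s * (u i s * v j s)) (J (i + j))"
    if "j > 0" for i j
    unfolding u_def v_def J_def by (rule power_kernel_convolution[OF assms(1,3) that])
  have uv_nonneg: "indicator {0<..<t} s * (u i s * v j s) \<ge> 0" for i j s
    using assms by (auto simp: u_def v_def indicator_def
        intro!: mult_nonneg_nonneg divide_nonneg_nonneg rGamma_real_nonneg)
  \<comment> \<open>For \<open>i = n\<close> the integral is not \<open>J n\<close>, because \<open>rGamma 0 = 0\<close>; there the coefficient of \<open>R ^ k\<close> vanishes.\<close>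
  have uvc: "has_bochner_integral lborel
          (\<lambda>s. c * waiting_coeff k (n - i) * (indicator {0<..<t} s * (u i s * v (n - i) s)))
          (c * waiting_coeff k (n - i) * J n)" if "i \<le> n" for i n c
    using uv[of "n - i" i] that k0 by (cases "i = n") (auto intro!: has_bochner_integral_mult_right)
  have w_int: "has_bochner_integral lborel (w n) (lam ^ n * waiting_coeff (m + k) n * J n)" for n
  proof -
    have "has_bochner_integral lborel (w n)
            (\<Sum>i\<le>n. lam ^ n * waiting_coeff m i * waiting_coeff k (n - i) * J n)"
      unfolding w_def mult.assoc [symmetric, of "lam ^ n" "waiting_coeff m _"]
      by (intro has_bochner_integral_sum uvc) auto
    also have "(\<Sum>i\<le>n. lam ^ n * waiting_coeff m i * waiting_coeff k (n - i) * J n) =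
                 lam ^ n * waiting_coeff (m + k) n * J n"
      by (simp add: waiting_coeff_add sum_distrib_left sum_distrib_right mult_ac)
    finally show ?thesis .
  qed
  have w_bound: "(\<integral>s. norm (w n s) \<partial>lborel) \<le> (4 * lam * t powr \<alpha>) ^ n * rGamma (\<alpha> * real n + 1)" for n
  proof -
    define g where "g = (\<lambda>i s. lam ^ n * \<bar>waiting_coeff m i\<bar> * \<bar>waiting_coeff k (n - i)\<bar> *
                              (indicator {0<..<t} s * (u i s * v (n - i) s)))"
    have g: "has_bochner_integral lborel (g i) (lam ^ n * \<bar>waiting_coeff m i\<bar> * \<bar>waiting_coeff k (n - i)\<bar> * J n)"
      if "i \<le> n" for i
      unfolding g_def using uv[of "n - i" i] that k0
      by (cases "i = n") (auto intro!: has_bochner_integral_mult_right)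
    have "has_bochner_integral lborel (\<lambda>s. \<Sum>i\<le>n. g i s)
            (\<Sum>i\<le>n. lam ^ n * \<bar>waiting_coeff m i\<bar> * \<bar>waiting_coeff k (n - i)\<bar> * J n)"
      by (intro has_bochner_integral_sum g) auto
    moreover have "norm (w n s) \<le> (\<Sum>i\<le>n. g i s)" for s
    proof -
      have le: "norm (L * (a * b) * X) \<le> L * \<bar>a\<bar> * \<bar>b\<bar> * X" if "L \<ge> 0" "X \<ge> 0" for L a b X :: real
        using that by (simp add: abs_mult)
      show ?thesis
        unfolding w_def g_def using assms by (intro sum_norm_le le uv_nonneg) simp
    qed
    ultimately have "(\<integral>s. norm (w n s) \<partial>lborel) \<le>
                       (\<Sum>i\<le>n. lam ^ n * \<bar>waiting_coeff m i\<bar> * \<bar>waiting_coeff k (n - i)\<bar> * J n)"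
      using w_int[of n] integral_mono[of lborel "\<lambda>s. norm (w n s)" "\<lambda>s. \<Sum>i\<le>n. g i s"]
      by (auto simp: has_bochner_integral_iff)
    also have "\<dots> \<le> (\<Sum>i\<le>n. lam ^ n * 2 ^ n * J n)"
    proof (rule sum_mono)
      fix i assume "i \<in> {..n}"
      hence "\<bar>waiting_coeff m i\<bar> * \<bar>waiting_coeff k (n - i)\<bar> \<le> 2 ^ n"
        using mult_mono[OF abs_waiting_coeff_le[of m i] abs_waiting_coeff_le[of k "n - i"]]
        by (simp flip: power_add)
      thus "lam ^ n * \<bar>waiting_coeff m i\<bar> * \<bar>waiting_coeff k (n - i)\<bar> * J n \<le> lam ^ n * 2 ^ n * J n"
        using assms J_nonneg[of n] unfolding mult.assoc[of "lam ^ n"]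
        by (intro mult_right_mono mult_left_mono) auto
    qed
    also have "\<dots> = real (Suc n) * (lam ^ n * 2 ^ n * J n)" by simp
    \<comment> \<open>The number of summands is absorbed by another power of \<open>2\<close>.\<close>
    also have "\<dots> \<le> 2 ^ n * (lam ^ n * 2 ^ n * J n)"
    proof (rule mult_right_mono)
      show "real (Suc n) \<le> 2 ^ n"
        using less_exp[of n] by (metis Suc_leI of_nat_le_iff of_nat_numeral of_nat_power)
    qed (use assms J_nonneg in auto)
    also have "\<dots> = (4 * lam * t powr \<alpha>) ^ n * rGamma (\<alpha> * real n + 1)"
      by (simp add: J_def power_mult_distrib flip: power_mult_distrib[of 2 2])
    finally show ?thesis .
  qed
  have w_sums: "(\<lambda>n. w n s) sums
      (indicator {0<..<t} s * (waiting_cdf \<alpha> lam m (t - s) * waiting_density \<alpha> lam k s)) \<and>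
      summable (\<lambda>n. norm (w n s))" for s
  proof (cases "s \<in> {0<..<t}")
    case True
    define a where "a = (\<lambda>i. waiting_coeff m i * (lam * (t - s) powr \<alpha>) ^ i * rGamma (\<alpha> * real i + 1))"
    define b where "b = (\<lambda>j. waiting_coeff k j * (lam * s powr \<alpha>) ^ j * rGamma (\<alpha> * real j) / s)"
    have a: "summable (\<lambda>i. norm (a i))"
      unfolding a_def using assms by (intro summable_waiting_series) auto
    have "summable (\<lambda>j. norm (waiting_coeff k j * (lam * s powr \<alpha>) ^ j * rGamma (\<alpha> * real j)))"
      using summable_waiting_series[of \<alpha> 0 k "lam * s powr \<alpha>"] assms by simp
    from summable_divide[OF this, of "\<bar>s\<bar>"] have b: "summable (\<lambda>j. norm (b j))"
      by (simp add: b_def abs_mult)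
    have w: "w n s = (\<Sum>i\<le>n. a i * b (n - i))" for n
      unfolding w_def
    proof (intro sum.cong refl)
      fix i assume "i \<in> {..n}"
      hence "lam ^ n = lam ^ i * lam ^ (n - i)" by (simp flip: power_add)
      thus "lam ^ n * (waiting_coeff m i * waiting_coeff k (n - i)) * (indicator {0<..<t} s * (u i s * v (n - i) s)) =
              a i * b (n - i)"
        using True by (simp add: a_def b_def u_def v_def power_mult_distrib)
    qed
    have suma: "(\<Sum>i. a i) = waiting_cdf \<alpha> lam m (t - s)"
      by (simp only: a_def waiting_cdf_def)
    have sumb: "(\<Sum>j. b j) = waiting_density \<alpha> lam k s"
      unfolding b_def waiting_density_def
      using summable_norm_cancel[OF summable_waiting_series[of \<alpha> 0 k "lam * s powr \<alpha>"]] assms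
      by (subst suminf_divide) simp_all
    have "(\<lambda>n. w n s) sums (waiting_cdf \<alpha> lam m (t - s) * waiting_density \<alpha> lam k s)"
      using Cauchy_product_sums[OF a b] unfolding w suma sumb .
    moreover have "summable (\<lambda>n. norm (w n s))"
    proof (rule summable_comparison_test')
      show "summable (\<lambda>n. \<Sum>i\<le>n. norm (a i) * norm (b (n - i)))"
        using a b by (intro summable_Cauchy_product) simp_all
      show "norm (norm (w n s)) \<le> (\<Sum>i\<le>n. norm (a i) * norm (b (n - i)))" for n
        unfolding w real_norm_def abs_idempotent
        by (rule order_trans[OF sum_abs]) (simp only: abs_mult order_refl)
    qed
    ultimately show ?thesis using True by simp
  qed (simp add: w_def)
  have summ: "summable (\<lambda>n. \<integral>s. norm (w n s) \<partial>lborel)"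
  proof (rule summable_comparison_test')
    show "summable (\<lambda>n. (4 * lam * t powr \<alpha>) ^ n * rGamma (\<alpha> * real n + 1))"
      using assms by (intro summable_power_rGamma) auto
    show "norm (\<integral>s. norm (w n s) \<partial>lborel) \<le> (4 * lam * t powr \<alpha>) ^ n * rGamma (\<alpha> * real n + 1)" for n
      using w_bound[of n] by simp
  qed
  have w_integrable: "integrable lborel (w n)" for n
    using w_int by (auto simp: has_bochner_integral_iff)
  have AE: "AE s in lborel. summable (\<lambda>n. norm (w n s))" using w_sums by auto
  have "(\<lambda>s. \<Sum>n. w n s) =
          (\<lambda>s. indicator {0<..<t} s * (waiting_cdf \<alpha> lam m (t - s) * waiting_density \<alpha> lam k s))"
    using w_sums by (auto simp: sums_iff fun_eq_iff)
  moreover have "(\<Sum>n. integral\<^sup>L lborel (w n)) = waiting_cdf \<alpha> lam (m + k) t"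
    using w_int by (simp add: has_bochner_integral_iff waiting_cdf_def J_def power_mult_distrib mult_ac)
  ultimately show ?thesis
    using integrable_suminf[OF w_integrable AE summ] integral_suminf[OF w_integrable AE summ]
    by (simp add: has_bochner_integral_iff)
qed

lemma waiting_density_nonneg:
  assumes "0 < \<alpha>" "\<alpha> \<le> 1" "lam > 0" "t > 0"
  shows "waiting_density \<alpha> lam k t \<ge> 0"
  unfolding waiting_density_def using assms
  by (intro divide_nonneg_nonneg waiting_series_nonneg) auto

text \<open>
  The \<open>j\<close>-th term of \<open>E\<close> with \<open>\<gamma> = 2\<close> carries the factor \<open>(- 1) ^ j * (j + 1)\<close>, which is the
  coefficient of \<open>R ^ 2\<close> at index \<open>j + 2\<close>; the prefactor \<open>lam ^ 2 * t powr (2 * \<alpha>)\<close> accounts for this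
  shift by \<open>2\<close>.
\<close>
lemma interarrival_density_eq:
  assumes "\<alpha> > 0" "lam > 0" "t > 0"
  shows "interarrival_density lam \<alpha> t = waiting_density \<alpha> lam 2 t"
proof -
  define y where "y = lam * t powr \<alpha>"
  have summ: "summable (\<lambda>N. waiting_coeff 2 N * y ^ N * rGamma (\<alpha> * real N))"
    using summable_norm_cancel[OF summable_waiting_series[of \<alpha> 0 2 y]] assms by simp
  define a where "a = (\<lambda>j. (1 + real j) * (- y) ^ j * rGamma (\<alpha> * real j + 2 * \<alpha>))"
  have a: "waiting_coeff 2 (j + 2) * y ^ (j + 2) * rGamma (\<alpha> * real (j + 2)) = y\<^sup>2 * a j" for j
    using waiting_coeff_2_Suc[of "Suc j"]
    by (simp add: a_def power2_eq_square power_minus[of y] algebra_simps)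
  have "(\<Sum>N. waiting_coeff 2 N * y ^ N * rGamma (\<alpha> * real N)) = 
          (\<Sum>j. waiting_coeff 2 (j + 2) * y ^ (j + 2) * rGamma (\<alpha> * real (j + 2)))"
    using suminf_split_initial_segment[OF summ, of 2] waiting_coeff_2_Suc[of 0]
    by (simp add: numeral_2_eq_2)
  also have "\<dots> = y\<^sup>2 * (\<Sum>j. a j)"
  proof -
    have "summable (\<lambda>j. inverse (y\<^sup>2) * (y\<^sup>2 * a j))"
      unfolding a [symmetric]
      by (intro summable_mult summable_ignore_initial_segment[OF summ, of 2])
    moreover have "y \<noteq> 0" using assms by (simp add: y_def)
    ultimately have "summable a" by (simp add: field_simps)
    thus ?thesis unfolding a by (rule suminf_mult)
  qed
  finally have 1: "waiting_density \<alpha> lam 2 t = y\<^sup>2 / t * (\<Sum>j. a j)"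
    by (simp add: waiting_density_def y_def)
  have "Gamma (real j + 2) = (1 + real j) * fact j" for j
    using Gamma_fact[of "Suc j", where 'a = real] by (simp add: add_ac)
  hence "Gamma (real j + 2) * (- y) ^ j / (fact j * Gamma (real j * \<alpha> + 2 * \<alpha>)) = a j" for j
    by (simp add: a_def rGamma_inverse_Gamma divide_inverse mult_ac)
  hence "mittag_leffler3 \<alpha> (2 * \<alpha>) 2 (- y) = (\<Sum>j. a j)"
    using Gamma_fact[of 1, where 'a = real] by (simp add: mittag_leffler3_def)
  hence 2: "interarrival_density lam \<alpha> t = lam\<^sup>2 * t powr (2 * \<alpha> - 1) * (\<Sum>j. a j)"
    using assms by (simp add: interarrival_density_def y_def)
  have "t powr (2 * \<alpha> - 1) = (t powr \<alpha>)\<^sup>2 / t"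
    using assms by (simp add: powr_diff powr_power mult.commute)
  thus ?thesis unfolding 1 2 by (simp add: y_def power_mult_distrib)
qed

lemma waiting_cdf_0_left: "waiting_cdf \<alpha> lam 0 t = 1"
proof -
  have "(\<Sum>N. waiting_coeff 0 N * (lam * t powr \<alpha>) ^ N * rGamma (\<alpha> * real N + 1)) =
        (\<Sum>N\<in>{0}. waiting_coeff 0 N * (lam * t powr \<alpha>) ^ N * rGamma (\<alpha> * real N + 1))"
    by (intro suminf_finite) (auto simp: waiting_coeff_0_left)
  thus ?thesis by (simp add: waiting_cdf_def waiting_coeff_0_left)
qed

lemma waiting_cdf_0_right:
  assumes "m > 0"
  shows "waiting_cdf \<alpha> lam m 0 = 0"
proof -
  obtain k where "m = Suc k" using assms by (cases m) auto
  hence "waiting_coeff m N * (lam * 0 powr \<alpha>) ^ N * rGamma (\<alpha> * real N + 1) = 0" for N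
    by (cases N) auto
  thus ?thesis unfolding waiting_cdf_def by (simp only: suminf_zero)
qed

text \<open>
  As \<open>R ^ 0 = 1\<close> stands for the constant function \<open>1\<close>, the convolution identity with \<open>m = 0\<close>
  exhibits the value as the integral of a nonnegative density.
\<close>
lemma waiting_cdf_nonneg:
  assumes "0 < \<alpha>" "\<alpha> \<le> 1" "lam > 0" "t \<ge> 0"
  shows "waiting_cdf \<alpha> lam m t \<ge> 0"
proof (cases "m = 0 \<or> t = 0")
  case True
  thus ?thesis by (cases "m = 0") (auto simp: waiting_cdf_0_left waiting_cdf_0_right)
next
  case False
  have "has_bochner_integral lborel
          (\<lambda>s. indicator {0<..<t} s * (waiting_cdf \<alpha> lam 0 (t - s) * waiting_density \<alpha> lam m s))
          (waiting_cdf \<alpha> lam (0 + m) t)"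
    using assms False by (intro waiting_cdf_convolution) auto
  hence "waiting_cdf \<alpha> lam m t =
           (\<integral>s. indicator {0<..<t} s * (waiting_cdf \<alpha> lam 0 (t - s) * waiting_density \<alpha> lam m s) \<partial>lborel)"
    by (simp add: has_bochner_integral_iff)
  also have "\<dots> \<ge> 0"
    using assms by (intro Bochner_Integration.integral_nonneg)
                   (auto simp: waiting_cdf_0_left indicator_def waiting_density_nonneg)
  finally show ?thesis .
qed

section \<open>Termwise differentiation of the Mittag-Leffler function\<close>

text \<open>
  The differential operator \<open>p - w * d / dw\<close> applied to an entire power series, term by term.
\<close>
lemma sums_falling_factor_series:
  fixes c :: "nat \<Rightarrow> real" and p w :: real
  assumes "\<And>w. summable (\<lambda>j. c j * w ^ j)"
  shows "(\<lambda>j. (p - real j) * c j * w ^ j) sums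
           (p * (\<Sum>j. c j * w ^ j) - w * (\<Sum>j. diffs c j * w ^ j))"
proof -
  have "(\<lambda>j. w * (diffs c j * w ^ j)) sums (w * (\<Sum>j. diffs c j * w ^ j))"
    by (intro sums_mult summable_sums termdiff_converges_all[OF assms])
  hence "(\<lambda>j. real (Suc j) * c (Suc j) * w ^ Suc j) sums (w * (\<Sum>j. diffs c j * w ^ j))"
    by (simp add: diffs_def mult_ac)
  hence "(\<lambda>j. real j * c j * w ^ j) sums (w * (\<Sum>j. diffs c j * w ^ j))"
    by (subst (asm) sums_Suc_iff) simp
  from sums_diff[OF sums_mult[OF summable_sums[OF assms], of p] this] show ?thesis
    by (simp add: algebra_simps)
qed

text \<open>
  Differentiating \<open>s powi (p - j)\<close> term by term; the sum is an entire function of \<open>1 / s\<close>, so the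
  chain rule reduces this to the termwise derivative of a power series.
\<close>
lemma has_derivative_powi_series:
  fixes c :: "nat \<Rightarrow> real" and p :: int
  assumes "\<And>w. summable (\<lambda>j. c j * w ^ j)" "s > 0"
  shows "((\<lambda>s. s powi p * (\<Sum>j. c j * (1 / s) ^ j)) has_real_derivative
           s powi (p - 1) * (\<Sum>j. (real_of_int p - real j) * c j * (1 / s) ^ j)) (at s)"
proof -
  have inner: "((\<lambda>s. 1 / s) has_real_derivative - (1 / s\<^sup>2)) (at s)"
    using assms by (auto intro!: derivative_eq_intros simp: power2_eq_square)
  have "((\<lambda>s. s powi p * (\<Sum>j. c j * (1 / s) ^ j)) has_real_derivative
          (p * s powi (p - 1)) * (\<Sum>j. c j * (1 / s) ^ j) +
          ((\<Sum>j. diffs c j * (1 / s) ^ j) * - (1 / s\<^sup>2)) * s powi p) (at s)"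
    using assms
    by (intro DERIV_mult DERIV_chain2[OF termdiffs_strong_converges_everywhere[OF assms(1)] inner])
       (auto intro!: derivative_eq_intros)
  also have "s powi p = s powi (p - 1) * s"
    using assms by (simp add: power_int_diff)
  also have "(p * s powi (p - 1)) * (\<Sum>j. c j * (1 / s) ^ j) +
          ((\<Sum>j. diffs c j * (1 / s) ^ j) * - (1 / s\<^sup>2)) * (s powi (p - 1) * s) =
        s powi (p - 1) * (p * (\<Sum>j. c j * (1 / s) ^ j) - (1 / s) * (\<Sum>j. diffs c j * (1 / s) ^ j))"
    using assms by (simp add: power2_eq_square field_simps)
  also have "\<dots> = s powi (p - 1) * (\<Sum>j. (real_of_int p - real j) * c j * (1 / s) ^ j)"
    using sums_falling_factor_series[OF assms(1), of p "1 / s"] by (simp add: sums_iff)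
  finally show "((\<lambda>s. s powi p * (\<Sum>j. c j * (1 / s) ^ j)) has_real_derivative
           s powi (p - 1) * (\<Sum>j. (real_of_int p - real j) * c j * (1 / s) ^ j)) (at s)" .
qed

lemma higher_deriv_powi_series:
  fixes c :: "nat \<Rightarrow> real" and p :: int
  assumes "\<And>w. summable (\<lambda>j. c j * w ^ j)" "s > 0"
  shows "(deriv ^^ k) (\<lambda>s. s powi p * (\<Sum>j. c j * (1 / s) ^ j)) s =
           s powi (p - int k) * (\<Sum>j. (\<Prod>i<k. real_of_int p - real j - real i) * c j * (1 / s) ^ j)"
proof -
  let ?c = "\<lambda>k j. (\<Prod>i<k. real_of_int p - real j - real i) * c j"
  have step: "?c (Suc k) j = (real_of_int (p - int k) - real j) * ?c k j" for k j
    by simp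
  have summ: "summable (\<lambda>j. ?c k j * w ^ j)" for k w
  proof (induction k arbitrary: w)
    case (Suc k)
    show ?case unfolding step
      by (rule sums_summable[OF sums_falling_factor_series[OF Suc.IH]])
  qed (use assms in simp)
  show ?thesis
    using assms(2)
  proof (induction k arbitrary: s)
    case (Suc k)
    have "(deriv ^^ Suc k) (\<lambda>s. s powi p * (\<Sum>j. c j * (1 / s) ^ j)) s =
            deriv ((deriv ^^ k) (\<lambda>s. s powi p * (\<Sum>j. c j * (1 / s) ^ j))) s"
      by simp
    also have "\<dots> = deriv (\<lambda>s. s powi (p - int k) * (\<Sum>j. ?c k j * (1 / s) ^ j)) s"
    proof (rule deriv_cong_ev)
      have "\<forall>\<^sub>F s in nhds s. s > 0"
        using Suc.prems by (intro order_tendstoD[OF filterlim_ident])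
      thus "\<forall>\<^sub>F s in nhds s. (deriv ^^ k) (\<lambda>s. s powi p * (\<Sum>j. c j * (1 / s) ^ j)) s =
              s powi (p - int k) * (\<Sum>j. ?c k j * (1 / s) ^ j)"
        by eventually_elim (rule Suc.IH)
    qed simp
    also have "\<dots> = s powi (p - int k - 1) * (\<Sum>j. (real_of_int (p - int k) - real j) * ?c k j * (1 / s) ^ j)"
      by (intro DERIV_imp_deriv has_derivative_powi_series summ Suc.prems)
    also have "p - int k - 1 = p - int (Suc k)" by simp
    finally show ?case unfolding step .
  qed simp
qed

text \<open>
  The factor produced by \<open>m\<close> differentiations is the generalised binomial coefficient
  \<open>(m - 1 - j) gchoose m\<close>, which equals \<open>(- 1) ^ m * (j choose m)\<close> by negation of the upper index.
\<close>
lemma higher_deriv_mittag_leffler: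
  fixes \<alpha> x :: real
  assumes "\<alpha> > 0"
  shows "1 / fact m * (deriv ^^ m) (\<lambda>s. s powi (int m - 1) * mittag_leffler \<alpha> 1 (- x / s)) 1 =
           (\<Sum>j. (waiting_coeff m j - waiting_coeff (Suc m) j) * x ^ j * rGamma (\<alpha> * real j + 1))"
proof -
  define c where "c = (\<lambda>j. (- x) ^ j * rGamma (\<alpha> * real j + 1))"
  have c_summable: "summable (\<lambda>j. c j * w ^ j)" for w
  proof (rule summable_comparison_test')
    show "summable (\<lambda>j. (\<bar>x\<bar> * \<bar>w\<bar>) ^ j * rGamma (\<alpha> * real j + 1))"
      using assms by (intro summable_power_rGamma) auto
    show "norm (c j * w ^ j) \<le> (\<bar>x\<bar> * \<bar>w\<bar>) ^ j * rGamma (\<alpha> * real j + 1)" for j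
      using assms rGamma_real_nonneg[of "\<alpha> * real j + 1"]
      by (simp add: c_def abs_mult power_abs power_mult_distrib)
  qed
  have mlf: "mittag_leffler \<alpha> 1 (- x / s) = (\<Sum>j. c j * (1 / s) ^ j)" for s
  proof -
    have "Gamma (real j + 1) * (- x / s) ^ j / (fact j * Gamma (real j * \<alpha> + 1)) = c j * (1 / s) ^ j" for j
    proof -
      have "(- x / s) ^ j = (- x) ^ j * (1 / s) ^ j"
        by (subst power_mult_distrib [symmetric]) simp
      moreover have "Gamma (real j + 1) = fact j"
        using Gamma_fact[of j, where 'a = real] by (simp add: add.commute)
      ultimately show ?thesis
        by (simp add: c_def rGamma_inverse_Gamma inverse_eq_divide mult.commute[of \<alpha>])
    qed
    thus ?thesis by (simp add: mittag_leffler_def mittag_leffler3_def)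
  qed
  have coeff: "inverse (fact m) * ((\<Prod>i<m. real_of_int (int m - 1) - real j - real i) * c j) =
                 (waiting_coeff m j - waiting_coeff (Suc m) j) * x ^ j * rGamma (\<alpha> * real j + 1)" for j
  proof -
    have "inverse (fact m) * (\<Prod>i<m. real_of_int (int m - 1) - real j - real i) =
            ((real m - 1 - real j) gchoose m)"
      by (simp add: gbinomial_prod_rev divide_inverse atLeast0LessThan mult.commute)
    also have "\<dots> = (-1) ^ m * real (j choose m)"
      by (subst gbinomial_negated_upper) (simp add: binomial_gbinomial)
    finally have "inverse (fact m) * ((\<Prod>i<m. real_of_int (int m - 1) - real j - real i) * c j) =
                    (-1) ^ m * real (j choose m) * c j"
      by (simp only: mult.assoc [symmetric])
    thus ?thesis
      by (simp add: waiting_coeff_diff c_def power_add power_minus[of x])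
  qed
  have summ: "summable (\<lambda>j. (\<Prod>i<m. real_of_int (int m - 1) - real j - real i) * c j)"
  proof -
    have "summable (\<lambda>j. waiting_coeff k j * x ^ j * rGamma (\<alpha> * real j + 1))" for k
      using summable_norm_cancel[OF summable_waiting_series[of \<alpha> 1 k x]] assms by simp
    hence "summable (\<lambda>j. fact m * (waiting_coeff m j * x ^ j * rGamma (\<alpha> * real j + 1) -
              waiting_coeff (Suc m) j * x ^ j * rGamma (\<alpha> * real j + 1)))"
      by (intro summable_mult summable_diff)
    also have "(\<lambda>j. fact m * (waiting_coeff m j * x ^ j * rGamma (\<alpha> * real j + 1) -
              waiting_coeff (Suc m) j * x ^ j * rGamma (\<alpha> * real j + 1))) =
          (\<lambda>j. (\<Prod>i<m. real_of_int (int m - 1) - real j - real i) * c j)"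
      using coeff by (simp add: fun_eq_iff field_simps)
    finally show ?thesis .
  qed
  have "1 / fact m * (deriv ^^ m) (\<lambda>s. s powi (int m - 1) * mittag_leffler \<alpha> 1 (- x / s)) 1 =
          inverse (fact m) * (\<Sum>j. (\<Prod>i<m. real_of_int (int m - 1) - real j - real i) * c j)"
    unfolding mlf by (subst higher_deriv_powi_series[OF c_summable]) (simp_all add: divide_inverse)
  also have "\<dots> = (\<Sum>j. inverse (fact m) * ((\<Prod>i<m. real_of_int (int m - 1) - real j - real i) * c j))"
    by (rule suminf_mult [symmetric, OF summ])
  finally show ?thesis unfolding coeff .
qed

lemma higher_deriv_mittag_leffler_eq_waiting_cdf:
  assumes "\<alpha> > 0"
  shows "1 / fact m * (deriv ^^ m) (\<lambda>s. s powi (int m - 1) * mittag_leffler \<alpha> 1 (- (lam * t powr \<alpha>) / s)) 1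
           = waiting_cdf \<alpha> lam m t - waiting_cdf \<alpha> lam (Suc m) t"
proof -
  let ?x = "lam * t powr \<alpha>"
  have "summable (\<lambda>j. waiting_coeff k j * ?x ^ j * rGamma (\<alpha> * real j + 1))" for k
    using summable_norm_cancel[OF summable_waiting_series[of \<alpha> 1 k ?x]] assms by simp
  from suminf_diff[OF this this, of m "Suc m"] show ?thesis
    unfolding higher_deriv_mittag_leffler[OF assms] waiting_cdf_def
    by (simp add: left_diff_distrib)
qed

section \<open>The renewal process\<close>

text \<open>
  The supremum of a nonempty bounded set of naturals is attained, and \<open>0\<close> always belongs to the set.
  For arbitrary outcomes the partial sums need not be monotone, hence the quantifier over all later
  epochs; this form also shows that the event is measurable.
\<close>
lemma renewal_count_eq_enat_iff:
  assumes "t \<ge> 0"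
  shows "renewal_count T t \<omega> = enat n \<longleftrightarrow>
           (\<Sum>i<n. T i \<omega>) \<le> t \<and> (\<forall>k>n. (\<Sum>i<k. T i \<omega>) > t)"
proof -
  let ?A = "{k. (\<Sum>i<k. T i \<omega>) \<le> t}"
  have zero: "0 \<in> ?A" using assms by simp
  show ?thesis
  proof
    assume *: "renewal_count T t \<omega> = enat n"
    have le: "k \<le> n" if "k \<in> ?A" for k
    proof -
      have "enat k \<le> (SUP k \<in> ?A. enat k)" using that by (rule SUP_upper)
      thus ?thesis using * by (simp add: renewal_count_def)
    qed
    have "n \<in> ?A"
    proof (rule ccontr)
      assume "n \<notin> ?A"
      hence lt: "k < n" if "k \<in> ?A" for k using le[OF that] that by (cases "k = n") auto
      have "(SUP k \<in> ?A. enat k) \<le> enat (n - 1)"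
      proof (rule SUP_least)
        fix k assume "k \<in> ?A"
        from lt[OF this] show "enat k \<le> enat (n - 1)" by simp
      qed
      thus False using * lt[OF zero] by (simp add: renewal_count_def)
    qed
    moreover have "(\<Sum>i<k. T i \<omega>) > t" if "k > n" for k
      using le[of k] that by force
    ultimately show "(\<Sum>i<n. T i \<omega>) \<le> t \<and> (\<forall>k>n. (\<Sum>i<k. T i \<omega>) > t)" by auto
  next
    assume *: "(\<Sum>i<n. T i \<omega>) \<le> t \<and> (\<forall>k>n. (\<Sum>i<k. T i \<omega>) > t)"
    show "renewal_count T t \<omega> = enat n"
      unfolding renewal_count_def
    proof (rule antisym)
      show "(SUP k \<in> ?A. enat k) \<le> enat n"
        using * by (intro SUP_least) (force simp: not_less [symmetric])
      show "enat n \<le> (SUP k \<in> ?A. enat k)"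
        using * by (intro SUP_upper) auto
    qed
  qed
qed

locale renewal_process = prob_space M for M :: "'a measure" +
  fixes lam \<alpha> :: real and T :: "nat \<Rightarrow> 'a \<Rightarrow> real"
  assumes lam: "lam > 0" and \<alpha>: "0 < \<alpha>" "\<alpha> \<le> 1"
    and indep: "indep_vars (\<lambda>_. borel) T UNIV"
    and distr: "\<And>i. distributed M lborel (T i) (\<lambda>x. ennreal (interarrival_density lam \<alpha> x))"
begin

lemma measurable_T [measurable]: "T i \<in> borel_measurable M"
  using distributed_measurable[OF distr[of i]] by simp

lemma measurable_density [measurable]: "(\<lambda>x. ennreal (interarrival_density lam \<alpha> x)) \<in> borel_measurable borel"
  using distributed_borel_measurable[OF distr[of 0]] by simp

lemma AE_T_pos: "AE \<omega> in M. \<forall>i. T i \<omega> > 0"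
proof (subst AE_all_countable, rule allI)
  fix i
  have "emeasure M (T i -` {..0} \<inter> space M) = (\<integral>\<^sup>+x. ennreal (interarrival_density lam \<alpha> x) * indicator {..0} x \<partial>lborel)"
    by (rule distributed_emeasure[OF distr]) simp
  also have "\<dots> = (\<integral>\<^sup>+x. 0 \<partial>(lborel :: real measure))"
    by (intro nn_integral_cong) (auto simp: indicator_def interarrival_density_def)
  finally have "T i -` {..0} \<inter> space M \<in> null_sets M"
    by (intro null_setsI) auto
  from AE_not_in[OF this] show "AE \<omega> in M. T i \<omega> > 0"
    using AE_space by eventually_elim auto
qed

text \<open>
  Conditioning on the last of \<open>k + 1\<close> interarrival times.
\<close>
lemma arrival_cdf_Suc:
  "emeasure M {\<omega>\<in>space M. (\<Sum>i<Suc k. T i \<omega>) \<le> t} =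
     (\<integral>\<^sup>+s. ennreal (interarrival_density lam \<alpha> s) *
            emeasure M {\<omega>\<in>space M. (\<Sum>i<k. T i \<omega>) \<le> t - s} \<partial>lborel)"
proof -
  let ?S = "\<lambda>\<omega>. \<Sum>i<k. T i \<omega>" and ?f = "\<lambda>x. ennreal (interarrival_density lam \<alpha> x)"
  have S: "?S \<in> borel_measurable M" by measurable
  have "indep_var borel (T k) borel ?S"
    by (intro indep_vars_sum indep_vars_subset[OF indep]) auto
  hence conv: "distr M borel (\<lambda>\<omega>. T k \<omega> + ?S \<omega>) = (distr M borel (T k) \<star> distr M borel ?S)"
    by (rule sum_indep_random_variable) auto
  have Tk: "distr M borel (T k) = density lborel ?f"
    using distributed_distr_eq_density[OF distr[of k]] by (simp cong: distr_cong)
  have "emeasure M {\<omega>\<in>space M. (\<Sum>i<Suc k. T i \<omega>) \<le> t} =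
          emeasure (distr M borel (\<lambda>\<omega>. T k \<omega> + ?S \<omega>)) {..t}"
    by (subst emeasure_distr) (auto intro!: arg_cong[where f = "emeasure M"] simp: add.commute)
  also have "\<dots> = (\<integral>\<^sup>+s. emeasure (distr M borel ?S) {a. a + s \<in> {..t}} \<partial>distr M borel (T k))"
    unfolding conv
    by (intro convolution_emeasure) (auto intro!: prob_space.finite_measure prob_space_distr)
  also have "\<dots> = (\<integral>\<^sup>+s. emeasure (distr M borel ?S) {..t - s} \<partial>distr M borel (T k))"
    by (intro nn_integral_cong arg_cong[where f = "emeasure _"]) auto
  also have "\<dots> = (\<integral>\<^sup>+s. ?f s * emeasure (distr M borel ?S) {..t - s} \<partial>lborel)"
    unfolding Tk
  proof (subst nn_integral_density)
    interpret S: prob_space "distr M borel ?S" by (rule prob_space_distr) fact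
    have "(\<lambda>s. emeasure (distr M borel ?S) {..t - s}) = (\<lambda>s. emeasure (distr M borel ?S) (Pair s -` {p \<in> space (borel \<Otimes>\<^sub>M borel). snd p \<le> t - fst p}))"
      by (intro ext arg_cong[where f = "emeasure _"]) (auto simp: space_pair_measure)
    also have "\<dots> \<in> borel_measurable borel"
      by (rule S.measurable_emeasure_Pair) measurable
    finally show "(\<lambda>s. emeasure (distr M borel ?S) {..t - s}) \<in> borel_measurable lborel" by simp
  qed auto
  also have "\<dots> = (\<integral>\<^sup>+s. ?f s * emeasure M {\<omega>\<in>space M. ?S \<omega> \<le> t - s} \<partial>lborel)"
    by (intro nn_integral_cong) (subst emeasure_distr[OF S], auto intro!: arg_cong[where f = "\<lambda>A. _ * emeasure M A"])
  finally show ?thesis .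
qed

text \<open>
  Induction on the number of interarrival times, each contributing a factor \<open>R ^ 2\<close>. Since the
  interarrival density and the distribution functions are nonnegative, the nonnegative integral of
  \<open>arrival_cdf_Suc\<close> is the Bochner integral of the convolution identity.
\<close>
lemma arrival_cdf:
  "emeasure M {\<omega>\<in>space M. (\<Sum>i<k. T i \<omega>) \<le> t} =
     (if t < 0 then 0 else ennreal (waiting_cdf \<alpha> lam (2 * k) t))"
proof (induction k arbitrary: t)
  case 0
  show ?case by (auto simp: waiting_cdf_0_left emeasure_space_1)
next
  case (Suc k)
  let ?F = "waiting_cdf \<alpha> lam (2 * k)"
  have *: "emeasure M {\<omega>\<in>space M. (\<Sum>i<Suc k. T i \<omega>) \<le> t} =
          (\<integral>\<^sup>+s. ennreal (interarrival_density lam \<alpha> s) *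
                 (if t - s < 0 then 0 else ennreal (?F (t - s))) \<partial>lborel)"
    unfolding arrival_cdf_Suc Suc.IH ..
  show ?case
  proof (cases "t > 0")
    case False
    have "AE s in lborel. s \<noteq> (0 :: real)" by (rule AE_lborel_singleton)
    hence "(\<integral>\<^sup>+s. ennreal (interarrival_density lam \<alpha> s) *
              (if t - s < 0 then 0 else ennreal (?F (t - s))) \<partial>lborel) = (\<integral>\<^sup>+s. 0 \<partial>(lborel :: real measure))"
      using False by (intro nn_integral_cong_AE) (auto simp: interarrival_density_def elim!: eventually_mono)
    thus ?thesis using False unfolding * by (cases "t = 0") (auto simp: waiting_cdf_0_right)
  next
    case True
    let ?g = "\<lambda>s. indicator {0<..<t} s * (?F (t - s) * waiting_density \<alpha> lam 2 s)"
    have f_nonneg: "waiting_density \<alpha> lam 2 s \<ge> 0" if "s > 0" for s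
      using lam \<alpha> that by (intro waiting_density_nonneg)
    have g: "has_bochner_integral lborel ?g (waiting_cdf \<alpha> lam (2 * k + 2) t)"
      using lam \<alpha> True by (intro waiting_cdf_convolution) auto
    have g_nonneg: "?g s \<ge> 0" for s
      using f_nonneg[of s] waiting_cdf_nonneg[OF \<alpha> lam, of "t - s" "2 * k"] by (auto simp: indicator_def)
    have "AE s in lborel. s \<noteq> t" by (rule AE_lborel_singleton)
    hence "(\<integral>\<^sup>+s. ennreal (interarrival_density lam \<alpha> s) *
              (if t - s < 0 then 0 else ennreal (?F (t - s))) \<partial>lborel) = (\<integral>\<^sup>+s. ennreal (?g s) \<partial>lborel)"
    proof (intro nn_integral_cong_AE, eventually_elim)
      fix s :: real assume "s \<noteq> t"
      show "ennreal (interarrival_density lam \<alpha> s) * (if t - s < 0 then 0 else ennreal (?F (t - s))) =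
              ennreal (?g s)"
      proof (cases "s > 0")
        case True
        thus ?thesis
          using \<open>s \<noteq> t\<close> f_nonneg[OF True] interarrival_density_eq[OF \<alpha>(1) lam True]
          by (auto simp: indicator_def ennreal_mult' [symmetric] mult.commute)
      qed (auto simp: interarrival_density_def indicator_def)
    qed
    also have "\<dots> = ennreal (waiting_cdf \<alpha> lam (2 * k + 2) t)"
      using g g_nonneg by (subst nn_integral_eq_integral) (auto simp: has_bochner_integral_iff)
    finally show ?thesis using True unfolding * by simp
  qed
qed

text \<open>
  Almost surely all interarrival times are positive, so the event is the difference of the nested
  events that the \<open>n\<close>-th and the \<open>n + 1\<close>-st epoch have occurred by time \<open>t\<close>.
\<close>
lemma prob_renewal_count_eq:
  assumes "t > 0"
  shows "\<P>(\<omega> in M. renewal_count T t \<omega> = enat n) =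
           waiting_cdf \<alpha> lam (2 * n) t - waiting_cdf \<alpha> lam (2 * n + 2) t"
proof -
  let ?A = "\<lambda>k. {\<omega>\<in>space M. (\<Sum>i<k. T i \<omega>) \<le> t}"
  have A: "?A k \<in> sets M" for k by measurable
  have prob_A: "prob (?A k) = waiting_cdf \<alpha> lam (2 * k) t" for k
    using arrival_cdf[of k t] waiting_cdf_nonneg[OF \<alpha> lam, of t "2 * k"] assms
    by (simp add: measure_def)
  have mono: "AE \<omega> in M. \<forall>k l. k \<le> l \<longrightarrow> (\<Sum>i<k. T i \<omega>) \<le> (\<Sum>i<l. T i \<omega>)"
    using AE_T_pos by eventually_elim (intro allI impI sum_mono2, auto intro: less_imp_le)
  have "\<P>(\<omega> in M. renewal_count T t \<omega> = enat n) = prob (?A n - ?A (Suc n))"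
  proof (rule measure_eq_AE)
    show "AE \<omega> in M. \<omega> \<in> {\<omega>\<in>space M. renewal_count T t \<omega> = enat n} \<longleftrightarrow> \<omega> \<in> ?A n - ?A (Suc n)"
      using mono
    proof eventually_elim
      case (elim \<omega>)
      have "(\<forall>k>n. (\<Sum>i<k. T i \<omega>) > t) \<longleftrightarrow> (\<Sum>i<Suc n. T i \<omega>) > t"
      proof
        assume *: "(\<Sum>i<Suc n. T i \<omega>) > t"
        show "\<forall>k>n. (\<Sum>i<k. T i \<omega>) > t"
        proof (intro allI impI)
          fix k assume "k > n"
          hence "(\<Sum>i<Suc n. T i \<omega>) \<le> (\<Sum>i<k. T i \<omega>)" using elim by (simp only: Suc_le_eq)
          with * show "(\<Sum>i<k. T i \<omega>) > t" by linarith
        qed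
      qed blast
      thus ?case
        unfolding mem_Collect_eq Diff_iff renewal_count_eq_enat_iff[OF less_imp_le[OF assms]]
        by (auto simp only: not_le)
    qed
    show "{\<omega>\<in>space M. renewal_count T t \<omega> = enat n} \<in> sets M"
      unfolding renewal_count_eq_enat_iff[OF less_imp_le[OF assms]] by measurable
  qed (use A in auto)
  also have "\<dots> = prob (?A n) - prob (?A n \<inter> ?A (Suc n))"
    using A by (intro finite_measure_Diff') auto
  also have "prob (?A n \<inter> ?A (Suc n)) = prob (?A (Suc n))"
  proof (rule measure_eq_AE)
    show "AE \<omega> in M. \<omega> \<in> ?A n \<inter> ?A (Suc n) \<longleftrightarrow> \<omega> \<in> ?A (Suc n)"
      using mono
    proof eventually_elim
      case (elim \<omega>)
      have "(\<Sum>i<n. T i \<omega>) \<le> (\<Sum>i<Suc n. T i \<omega>)"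
        using elim by (blast intro: le_SucI)
      thus ?case
        unfolding Int_iff mem_Collect_eq using order_trans by blast
    qed
  qed (use A in auto)
  finally show ?thesis unfolding prob_A by simp
qed

end

theorem proposition3p1:
  fixes lam \<alpha> t :: real and n :: nat
    and M :: "'a measure" and T :: "nat \<Rightarrow> 'a \<Rightarrow> real"
  assumes "lam > 0" and "0 < \<alpha>" and "\<alpha> \<le> 1"
    and "prob_space M"
    and "prob_space.indep_vars M (\<lambda>_. borel) T UNIV"
    and "\<And>i. distributed M lborel (T i) (\<lambda>x. ennreal (interarrival_density lam \<alpha> x))"
    and "t > 0"
  shows "\<P>(\<omega> in M. renewal_count T t \<omega> = enat n) =
    1 / fact (2 * n) *
      (deriv ^^ (2 * n))
        (\<lambda>s. s powi (2 * int n - 1) * mittag_leffler \<alpha> 1 (- (lam * t powr \<alpha>) / s)) 1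
    + 1 / fact (2 * n + 1) *
      (deriv ^^ (2 * n + 1))
        (\<lambda>s. s powi (2 * int n) * mittag_leffler \<alpha> 1 (- (lam * t powr \<alpha>) / s)) 1"
proof -
  interpret prob_space M by fact
  interpret renewal_process M lam \<alpha> T
    by unfold_locales (use assms in auto)
  have exponents: "int (2 * n) - 1 = 2 * int n - 1" "int (2 * n + 1) - 1 = 2 * int n" by simp_all
  show ?thesis
    using higher_deriv_mittag_leffler_eq_waiting_cdf[OF \<open>0 < \<alpha>\<close>, of "2 * n" lam t]
          higher_deriv_mittag_leffler_eq_waiting_cdf[OF \<open>0 < \<alpha>\<close>, of "2 * n + 1" lam t]
    unfolding exponents prob_renewal_count_eq[OF \<open>t > 0\<close>] by simp
qed

end
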